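(* There is a universal constant $C>0$ such that for all $0\le\alpha\le1$, $n\ge1$, $V\ge0$, $\sigma>0$ and every flow $\mu\in\mathcal F(\mathcal T_{\alpha,n})$ with root value $\mu_1\le V$, the least squares estimator $\hat\mu$ satisfies $$\mathbb E\,\frac1n\|\hat\mu-\mu\|^2\ \le\ C\Bigl(\frac{\sigma^2(\log(en))^3}{n^\alpha}+V\,\frac{\sigma(\log(en))^{3/2}}{n^\alpha}\Bigr).$$
   Context: For $0\le\alpha\le1$ and a positive integer $n$, put $m=\lceil n^\alpha\rceil$ and $l=\lceil n^{1-\alpha}\rceil$. The rooted tree $\mathcal T_{\alpha,n}$ has a root with $m$ children, each of which is the first vertex of a path with $l$ vertices; it has $lm+1=\Theta(n)$ vertices. A flow $\mu$ on it consists of a root value $\mu_1$ and values $\mu^{(j)}_i$ ($1\le j\le m$, $1\le i\le l$) along the paths; the set of flows $\mathcal F(\mathcal T_{\alpha,n})$ is the closed convex cone defined by $\mu_1\ge\sum_{j=1}^m\mu^{(j)}_1$ and $\mu^{(j)}_1\ge\mu^{(j)}_2\ge\cdots\ge\mu^{(j)}_l\ge0$ for each $j$. The data are $Y=\mu+\epsilon$ with one independent $N(0,\sigma^2)$ error at each vertex. The least squares estimator $\hat\mu$ is the Euclidean projection of $Y$ onto $\mathcal F(\mathcal T_{\alpha,n})$. $\|\cdot\|$ is the Euclidean norm over all vertices, $e$ inside $\log(en)$ is Euler's number, and $\mathbb E$ is expectation under the true $\mu$. *)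

theory Defs
  imports "HOL-Probability.Probability"
begin

definition num_paths :: "real \<Rightarrow> nat \<Rightarrow> nat" where
  "num_paths \<alpha> n = nat \<lceil>real n powr \<alpha>\<rceil>"

definition path_length :: "real \<Rightarrow> nat \<Rightarrow> nat" where
  "path_length \<alpha> n = nat \<lceil>real n powr (1 - \<alpha>)\<rceil>"

text \<open>\<open>Node j i\<close> is the \<open>i\<close>-th vertex of the \<open>j\<close>-th path, both indices counted from 1; the
  vertices \<open>Node j 1\<close> are the children of the root.\<close>

datatype vertex = Root | Node nat nat

definition tree_vertices :: "real \<Rightarrow> nat \<Rightarrow> vertex set" where
  "tree_vertices \<alpha> n =
     insert Root {Node j i | j i. j \<in> {1..num_paths \<alpha> n} \<and> i \<in> {1..path_length \<alpha> n}}"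

text \<open>Vectors indexed by the vertices are functions that are \<open>undefined\<close> off the vertex set
  (the convention of \<open>PiM\<close>), so that a flow is determined by its values on the tree.\<close>

definition flows :: "real \<Rightarrow> nat \<Rightarrow> (vertex \<Rightarrow> real) set" where
  "flows \<alpha> n = {\<mu> \<in> extensional (tree_vertices \<alpha> n).
     (\<Sum>j = 1..num_paths \<alpha> n. \<mu> (Node j 1)) \<le> \<mu> Root \<and>
     (\<forall>j \<in> {1..num_paths \<alpha> n}.
        (\<forall>i \<in> {1..<path_length \<alpha> n}. \<mu> (Node j (Suc i)) \<le> \<mu> (Node j i)) \<and>
        0 \<le> \<mu> (Node j (path_length \<alpha> n)))}"

definition tree_dist :: "real \<Rightarrow> nat \<Rightarrow> (vertex \<Rightarrow> real) \<Rightarrow> (vertex \<Rightarrow> real) \<Rightarrow> real" where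
  "tree_dist \<alpha> n x y = L2_set (\<lambda>v. x v - y v) (tree_vertices \<alpha> n)"

text \<open>The minimiser exists and is unique, since the flows form a nonempty closed convex subset
  of a Euclidean space. The library's \<open>closest_point\<close> is not applicable because the dimension
  depends on \<open>n\<close>.\<close>

definition lse :: "real \<Rightarrow> nat \<Rightarrow> (vertex \<Rightarrow> real) \<Rightarrow> (vertex \<Rightarrow> real)" where
  "lse \<alpha> n y = arg_min_on (tree_dist \<alpha> n y) (flows \<alpha> n)"

text \<open>The joint law of the errors: independent \<open>N(0, \<sigma>\<^sup>2)\<close>, one per vertex. The second argument
  of \<open>normal_density\<close> is the standard deviation.\<close>

definition error_law :: "real \<Rightarrow> nat \<Rightarrow> real \<Rightarrow> (vertex \<Rightarrow> real) measure" where
  "error_law \<alpha> n \<sigma> = PiM (tree_vertices \<alpha> n) (\<lambda>_. density lborel (normal_density 0 \<sigma>))"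

definition scaled_loss ::
  "real \<Rightarrow> nat \<Rightarrow> (vertex \<Rightarrow> real) \<Rightarrow> (vertex \<Rightarrow> real) \<Rightarrow> real" where
  "scaled_loss \<alpha> n \<mu> \<epsilon> =
     1 / real n * (tree_dist \<alpha> n (lse \<alpha> n (\<lambda>v. \<mu> v + \<epsilon> v)) \<mu>)\<^sup>2"

end

theory Submission
  imports Defs
begin

text \<open>The projection property gives \<open>d\<^sup>2 \<le> \<langle>\<epsilon>, \<delta>\<rangle>\<close> for the error \<open>\<delta>\<close> of the estimator and its norm
  \<open>d\<close>. A flow decreases along each path and its first values sum to at most its root value, so
  summation by parts bounds its inner product with \<open>\<epsilon>\<close> off the root by its root value times the
  maximum \<open>M\<close> of the absolute partial sums of the errors along the paths. Hence
  \<open>d\<^sup>2 \<le> (\<bar>\<epsilon> Root\<bar> + M) d + 2 V M\<close>, which gives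
  \<open>d\<^sup>2 \<le> (\<bar>\<epsilon> Root\<bar> + M)\<^sup>2 + 4 V M\<close>. The maximum runs over at most \<open>4 n\<close> centred Gaussians of
  variance at most \<open>l \<sigma>\<^sup>2\<close>, where \<open>l\<close> is the length of the paths; therefore \<open>M\<^sup>2\<close> has
  expectation of order \<open>l \<sigma>\<^sup>2 ln (e n)\<close>. The loss is measurable because the projection is
  nonexpansive, hence continuous.\<close>

section \<open>Euclidean projection onto closed convex sets of functions\<close>

lemma continuous_on_L2_set_diff: "continuous_on UNIV (\<lambda>x::'a \<Rightarrow> real. L2_set (\<lambda>v. y v - x v) T)"
  unfolding L2_set_def by (intro continuous_intros continuous_on_product_coordinates)

lemma abs_le_L2_set:
  assumes "finite T" "v \<in> T" shows "\<bar>f v\<bar> \<le> L2_set f T"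
  using member_le_L2_set[of T v "\<lambda>v. \<bar>f v\<bar>"] assms by (simp add: L2_set_def)

lemma sum_mult_le_L2_set: "(\<Sum>v\<in>T. f v * g v) \<le> L2_set f T * L2_set g T"
proof -
  have "(\<Sum>v\<in>T. f v * g v) \<le> (\<Sum>v\<in>T. \<bar>f v\<bar> * \<bar>g v\<bar>)"
    by (intro sum_mono) (simp add: abs_mult[symmetric])
  then show ?thesis
    using L2_set_mult_ineq[of f g T] by linarith
qed

lemma abs_L2_set_diff_le: "\<bar>L2_set f T - L2_set g T\<bar> \<le> L2_set (\<lambda>v. f v - g v) T"
proof -
  have "L2_set f T \<le> L2_set (\<lambda>v. f v - g v) T + L2_set g T"
    using L2_set_triangle_ineq[of "\<lambda>v. f v - g v" g T] by simp
  moreover have "L2_set g T \<le> L2_set (\<lambda>v. f v - g v) T + L2_set f T"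
    using L2_set_triangle_ineq[of "\<lambda>v. g v - f v" f T]
    by (simp add: L2_set_def power2_commute)
  ultimately show ?thesis by linarith
qed

text \<open>Any competitor at least as good as a fixed \<open>x0\<close> lies in a compact box
  around \<open>y\<close>, so a minimiser over the part of \<open>K\<close> in that box is a global
  one.\<close>

lemma ex_L2_minimizer:
  fixes K :: "('a \<Rightarrow> real) set"
  assumes T: "finite T" and K: "closed K" "K \<noteq> {}" "K \<subseteq> extensional T"
  shows "\<exists>x\<in>K. \<forall>z\<in>K. L2_set (\<lambda>v. y v - x v) T \<le> L2_set (\<lambda>v. y v - z v) T"
proof -
  let ?d = "\<lambda>x. L2_set (\<lambda>v. y v - x v) T"
  obtain x0 where x0: "x0 \<in> K" using K by auto
  \<comment> \<open>Off \<open>T\<close> the factor is the single point \<open>undefined\<close>: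
    together with \<open>K \<subseteq> extensional T\<close> this makes the box compact by Tychonoff
    although the index type may be infinite.\<close>
  define S where "S = (\<lambda>v. if v \<in> T then {y v - ?d x0 .. y v + ?d x0} else {undefined})"
  have "compact (PiE UNIV S)"
    using compactin_PiE[of "\<lambda>_. euclidean" UNIV S]
    by (simp add: euclidean_product_topology S_def)
  then have comp: "compact (PiE UNIV S \<inter> K)"
    using K(1) by (rule compact_Int_closed)
  have inS: "z \<in> PiE UNIV S" if "z \<in> K" "?d z \<le> ?d x0" for z
  proof -
    have "\<bar>y v - z v\<bar> \<le> ?d x0" if "v \<in> T" for v
      using abs_le_L2_set[OF T that, of "\<lambda>v. y v - z v"] \<open>?d z \<le> ?d x0\<close> by linarith
    then have "z v \<in> S v" for v
      using that K(3) by (fastforce simp: S_def extensional_def abs_le_iff)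
    then show ?thesis by auto
  qed
  have "PiE UNIV S \<inter> K \<noteq> {}" using inS[OF x0] x0 by auto
  from continuous_attains_inf[OF comp this
      continuous_on_subset[OF continuous_on_L2_set_diff subset_UNIV]]
  obtain x where x: "x \<in> K" "\<And>z. z \<in> PiE UNIV S \<inter> K \<Longrightarrow> ?d x \<le> ?d z" by blast
  have "?d x \<le> ?d x0" using x(2) inS[OF x0] x0 by auto
  \<comment> \<open>Points of \<open>K\<close> outside the box are farther from \<open>y\<close>
    than \<open>x0\<close>, hence farther than \<open>x\<close>.\<close>
  then have "?d x \<le> ?d z" if "z \<in> K" for z
    using x(2)[of z] inS[OF that] that by fastforce
  with x(1) show ?thesis by blast
qed

text \<open>First-order condition for the minimum along the segment from \<open>x\<close> to
  \<open>z\<close>: the squared distance changes by -2 t A + t^2 B, so a positive \<open>A\<close>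
  would lower it for small t.\<close>

lemma L2_minimizer_variational:
  fixes x y z :: "'a \<Rightarrow> real"
  assumes seg: "\<And>t. 0 < t \<Longrightarrow> t \<le> 1 \<Longrightarrow> (\<lambda>v. (1 - t) * x v + t * z v) \<in> K"
    and min: "\<And>w. w \<in> K \<Longrightarrow> L2_set (\<lambda>v. y v - x v) T \<le> L2_set (\<lambda>v. y v - w v) T"
  shows "(\<Sum>v\<in>T. (y v - x v) * (z v - x v)) \<le> 0"
proof (rule ccontr)
  define A where "A = (\<Sum>v\<in>T. (y v - x v) * (z v - x v))"
  define B where "B = (\<Sum>v\<in>T. (z v - x v)\<^sup>2)"
  assume "\<not> ?thesis"
  then have A: "A > 0" by (simp add: A_def)
  have B: "B \<ge> 0" by (simp add: B_def sum_nonneg)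
  have ineq: "2 * A \<le> t * B" if t: "0 < t" "t \<le> 1" for t
  proof -
    have "(\<Sum>v\<in>T. (y v - x v)\<^sup>2) \<le> (\<Sum>v\<in>T. (y v - ((1 - t) * x v + t * z v))\<^sup>2)"
      using min[OF seg[OF t]] by (simp add: L2_set_def)
    also have "\<dots> = (\<Sum>v\<in>T. (y v - x v)\<^sup>2) - 2 * t * A + t\<^sup>2 * B"
      by (simp add: A_def B_def sum_distrib_left sum.distrib[symmetric] sum_subtractf[symmetric]
          power2_eq_square algebra_simps)
    finally have "t * (2 * A) \<le> t * (t * B)" by (simp add: power2_eq_square mult_ac)
    then show ?thesis using t by simp
  qed
  \<comment> \<open>This value satisfies both \<open>t \<le> 1\<close> and
    \<open>t * B \<le> A\<close>, so \<open>ineq\<close> yields 2 A \<le> A, against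
    \<open>A > 0\<close>.\<close>
  define t where "t = A / (A + B)"
  have "0 < t" "t \<le> 1" using A B by (auto simp: t_def)
  moreover have "t * B \<le> A"
    using A B by (simp add: t_def field_simps)
  ultimately show False using ineq[of t] A by linarith
qed

text \<open>Adding the two variational inequalities bounds the squared distance of the projections
  by the inner product of \<open>y - y'\<close> with \<open>x - x'\<close>; Cauchy-Schwarz
  finishes.\<close>

lemma L2_projection_nonexpansive:
  fixes x x' y y' :: "'a \<Rightarrow> real"
  assumes "(\<Sum>v\<in>T. (y v - x v) * (x' v - x v)) \<le> 0"
    and "(\<Sum>v\<in>T. (y' v - x' v) * (x v - x' v)) \<le> 0"
  shows "L2_set (\<lambda>v. x v - x' v) T \<le> L2_set (\<lambda>v. y v - y' v) T"
proof -
  let ?d = "L2_set (\<lambda>v. x v - x' v) T"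
  have "?d\<^sup>2 = (\<Sum>v\<in>T. (x v - x' v)\<^sup>2)" by (simp add: L2_set_def sum_nonneg)
  then have "?d\<^sup>2 - (\<Sum>v\<in>T. (y v - y' v) * (x v - x' v))
      = (\<Sum>v\<in>T. (y v - x v) * (x' v - x v)) + (\<Sum>v\<in>T. (y' v - x' v) * (x v - x' v))"
    by (simp add: sum.distrib[symmetric] sum_subtractf[symmetric]
        power2_eq_square algebra_simps)
  with assms have "?d * ?d \<le> (\<Sum>v\<in>T. (y v - y' v) * (x v - x' v))"
    by (simp add: power2_eq_square)
  also have "\<dots> \<le> L2_set (\<lambda>v. y v - y' v) T * ?d"
    by (rule sum_mult_le_L2_set)
  finally show ?thesis
    by (cases "?d = 0") (auto simp: less_le)
qed

text \<open>The distance over \<open>T\<close> is continuous in the product topology, so the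
  Lipschitz bound squeezes \<open>f y - f x\<close> to 0.\<close>

lemma continuous_on_if_L2_Lipschitz:
  fixes f :: "('a \<Rightarrow> real) \<Rightarrow> real"
  assumes "\<And>x y. \<bar>f x - f y\<bar> \<le> L2_set (\<lambda>v. x v - y v) T"
  shows "continuous_on UNIV f"
proof -
  have "(f \<longlongrightarrow> f x) (at x)" for x
  proof -
    have "((\<lambda>y. L2_set (\<lambda>v. x v - y v) T) \<longlongrightarrow> L2_set (\<lambda>v. x v - x v) T) (at x)"
      using continuous_on_L2_set_diff[of x T] unfolding continuous_on_def by blast
    then have "((\<lambda>y. L2_set (\<lambda>v. x v - y v) T) \<longlongrightarrow> 0) (at x)" by (simp add: L2_set_def)
    then have "((\<lambda>y. f y - f x) \<longlongrightarrow> 0) (at x)"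
      by (rule Lim_null_comparison[rotated])
         (use assms[of x] in \<open>auto simp: abs_minus_commute intro!: always_eventually\<close>)
    then show ?thesis by (simp add: LIM_zero_iff)
  qed
  then show ?thesis by (simp add: continuous_on_def)
qed

text \<open>Over a countable index type the Borel sets of the product topology form the product
  sigma-algebra. It therefore suffices that the inclusion of \<open>PiM T M\<close> into the full
  function space is measurable, coordinate by coordinate.\<close>

lemma continuous_imp_measurable_PiM:
  fixes f :: "('a::countable \<Rightarrow> real) \<Rightarrow> real"
  assumes "continuous_on UNIV f" and sets: "\<And>v. v \<in> T \<Longrightarrow> sets (M v) = sets borel"
  shows "f \<in> borel_measurable (PiM T M)"
proof -
  have "(\<lambda>x. \<lambda>v\<in>UNIV. x v) \<in> PiM T M \<rightarrow>\<^sub>M PiM UNIV (\<lambda>_. borel)"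
  proof (rule measurable_restrict)
    fix v :: 'a
    show "(\<lambda>x. x v) \<in> borel_measurable (PiM T M)"
    proof (cases "v \<in> T")
      case True
      then have "(\<lambda>x. x v) \<in> PiM T M \<rightarrow>\<^sub>M M v" by simp
      then show ?thesis using measurable_cong_sets[OF refl sets[OF True]] by blast
    next
      \<comment> \<open>Off \<open>T\<close> every point of the space has the value
        \<open>undefined\<close>, so this coordinate is constant.\<close>
      case False
      then have "x v = undefined" if "x \<in> space (PiM T M)" for x
        using that by (auto simp: space_PiM PiE_def extensional_def)
      then show ?thesis using measurable_cong[of "PiM T M" "\<lambda>x. x v" "\<lambda>_. undefined" borel] by simp
    qed
  qed
  then have "(\<lambda>x. x) \<in> PiM T M \<rightarrow>\<^sub>M borel"
    by (simp add: measurable_cong_sets[OF refl sets_PiM_equal_borel] restrict_def)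
  from measurable_compose[OF this borel_measurable_continuous_onI[OF assms(1)]]
  show ?thesis .
qed

section \<open>Summation by parts\<close>

lemma abs_sum_mult_antimono_le:
  fixes e a :: "nat \<Rightarrow> real"
  assumes "1 \<le> l" and dec: "\<And>i. i \<in> {1..<l} \<Longrightarrow> a (Suc i) \<le> a i" and "0 \<le> a l"
    and M: "\<And>k. k \<in> {1..l} \<Longrightarrow> \<bar>\<Sum>i=1..k. e i\<bar> \<le> M"
  shows "\<bar>\<Sum>i=1..l. e i * a i\<bar> \<le> M * a 1"
proof -
  \<comment> \<open>The induction treats the weighted sum minus its boundary term: this difference
    vanishes at \<open>k = 1\<close> and each step adds one drop of \<open>a\<close> times a partial
    sum of \<open>e\<close>.\<close>
  have "\<bar>(\<Sum>i=1..k. e i * a i) - a k * (\<Sum>i=1..k. e i)\<bar> \<le> M * (a 1 - a k)"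
    if "1 \<le> k" "k \<le> l" for k
    using that
  proof (induction k rule: nat_induct_at_least)
    case base
    then show ?case by simp
  next
    case (Suc k)
    have "(\<Sum>i=1..Suc k. e i * a i) - a (Suc k) * (\<Sum>i=1..Suc k. e i)
        = ((\<Sum>i=1..k. e i * a i) - a k * (\<Sum>i=1..k. e i)) + (a k - a (Suc k)) * (\<Sum>i=1..k. e i)"
      by (simp add: algebra_simps)
    also have "\<bar>\<dots>\<bar> \<le> M * (a 1 - a k) + (a k - a (Suc k)) * M"
    proof (rule order_trans[OF abs_triangle_ineq add_mono])
      show "\<bar>(a k - a (Suc k)) * (\<Sum>i=1..k. e i)\<bar> \<le> (a k - a (Suc k)) * M"
        using M[of k] dec[of k] Suc by (simp add: abs_mult mult_left_mono)
    qed (use Suc in simp)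
    finally show ?case by (simp add: algebra_simps)
  qed
  from this[of l] have "\<bar>(\<Sum>i=1..l. e i * a i) - a l * (\<Sum>i=1..l. e i)\<bar> \<le> M * (a 1 - a l)"
    using assms(1) by simp
  \<comment> \<open>The boundary term at \<open>l\<close> costs \<open>a l * M\<close>, exactly what
    completes \<open>M * (a 1 - a l)\<close> to \<open>M * a 1\<close>.\<close>
  moreover have "\<bar>a l * (\<Sum>i=1..l. e i)\<bar> \<le> a l * M"
    using M[of l] assms by (simp add: abs_mult mult_left_mono)
  ultimately show ?thesis by (simp add: algebra_simps)
qed

section \<open>Gaussian sums and their exponential moments\<close>

text \<open>Multiplying the density by \<open>exp (x\<^sup>2 / (4 s\<^sup>2))\<close> gives \<open>sqrt 2\<close> times the centred normal
  density of variance \<open>2 s\<^sup>2\<close>.\<close>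

lemma distributed_normal_exp_square:
  assumes X: "distributed M lborel X (normal_density 0 s)" and s: "0 < s" "s\<^sup>2 \<le> v"
  shows "integrable M (\<lambda>x. exp ((X x)\<^sup>2 / (4 * v)))" (is ?int)
    and "(\<integral>x. exp ((X x)\<^sup>2 / (4 * v)) \<partial>M) \<le> sqrt 2" (is ?le)
proof -
  let ?g = "\<lambda>x::real. exp (x\<^sup>2 / (4 * s\<^sup>2))"
  have *: "normal_density 0 s x * ?g x = sqrt 2 * normal_density 0 (sqrt 2 * s) x" for x
  proof -
    have "exp (- (x\<^sup>2 / (2 * s\<^sup>2))) * ?g x = exp (- (x\<^sup>2 / (4 * s\<^sup>2)))"
      using s by (simp add: exp_add[symmetric] field_simps)
    then show ?thesis
      using s by (simp add: normal_density_def power_mult_distrib real_sqrt_mult field_simps)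
  qed
  have int: "integrable M (\<lambda>x. ?g (X x))"
    by (subst distributed_integrable[OF X, symmetric]) (use s in \<open>auto simp: *\<close>)
  have val: "(\<integral>x. ?g (X x) \<partial>M) = sqrt 2"
    by (subst distributed_integral[OF X, symmetric]) (use s in \<open>auto simp: *\<close>)
  have X': "X \<in> borel_measurable M"
    using distributed_measurable[OF X] by simp
  \<comment> \<open>A larger \<open>v\<close> only lowers the exponential, so one scale can serve
    sums of different variances.\<close>
  have le: "exp ((X x)\<^sup>2 / (4 * v)) \<le> ?g (X x)" for x
    using s by (auto intro!: divide_left_mono mult_pos_pos order_less_le_trans[of 0 "s\<^sup>2" v])
  show ?int
    by (rule Bochner_Integration.integrable_bound[OF int]) (use X' le in auto)
  then show ?le
    using integral_mono[OF _ int le] val by simp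
qed

text \<open>The coordinates are independent normals, so their variances add. A general index set
  \<open>I\<close> covers both the partial sums along a path and the single root error.\<close>

lemma distributed_sum_PiM_normal:
  assumes T: "finite T" and I: "I \<subseteq> T" "I \<noteq> {}" and s: "0 < s"
  shows "distributed (PiM T (\<lambda>_. density lborel (normal_density 0 s))) lborel
    (\<lambda>\<omega>. \<Sum>v\<in>I. \<omega> v) (normal_density 0 (sqrt (real (card I)) * s))"
proof -
  define N where "N = density lborel (\<lambda>x. ennreal (normal_density 0 s x))"
  have N: "prob_space N"
    using s by (simp add: N_def prob_space_normal_density)
  have sN[measurable_cong]: "sets N = sets borel" by (simp add: N_def)
  interpret P: prob_space "PiM T (\<lambda>_. N)"
    by (rule prob_space_PiM) (rule N)
  have comp: "(\<lambda>\<omega>. \<omega> v) \<in> borel_measurable (PiM T (\<lambda>_. N))" if "v \<in> T" for v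
    using that by measurable
  have marg: "distr (PiM T (\<lambda>_. N)) borel (\<lambda>\<omega>. \<omega> v) = N" if "v \<in> T" for v
  proof -
    have "distr (PiM T (\<lambda>_. N)) borel (\<lambda>\<omega>. \<omega> v) = distr (PiM T (\<lambda>_. N)) N (\<lambda>\<omega>. \<omega> v)"
      by (rule distr_cong) (auto simp: sN)
    also have "\<dots> = N" by (rule distr_PiM_component) (use N that in auto)
    finally show ?thesis .
  qed
  \<comment> \<open>Independence amounts to the joint law being the product of the marginals; here
    restriction to \<open>T\<close> is the identity on the space, and each marginal is
    \<open>N\<close>.\<close>
  have "P.indep_vars (\<lambda>_. borel) (\<lambda>v \<omega>. \<omega> v) T"
  proof (subst P.indep_vars_iff_distr_eq_PiM')
    have "distr (PiM T (\<lambda>_. N)) (PiM T (\<lambda>_. borel)) (\<lambda>\<omega>. \<lambda>v\<in>T. \<omega> v)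
        = distr (PiM T (\<lambda>_. N)) (PiM T (\<lambda>_. N)) (\<lambda>\<omega>. \<omega>)"
      by (rule distr_cong) (auto simp: space_PiM sN intro!: sets_PiM_cong)
    then show "distr (PiM T (\<lambda>_. N)) (PiM T (\<lambda>_. borel)) (\<lambda>\<omega>. \<lambda>v\<in>T. \<omega> v)
        = PiM T (\<lambda>v. distr (PiM T (\<lambda>_. N)) borel (\<lambda>\<omega>. \<omega> v))"
      by (simp add: marg distr_id2 cong: PiM_cong)
  qed (use I comp in auto)
  then have "P.indep_vars (\<lambda>_. borel) (\<lambda>v \<omega>. \<omega> v) I"
    by (rule P.indep_vars_subset) (rule I)
  moreover have "distributed (PiM T (\<lambda>_. N)) lborel (\<lambda>\<omega>. \<omega> v) (normal_density 0 s)" if "v \<in> I" for v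
  proof -
    have v: "v \<in> T" using I that by auto
    have "distr (PiM T (\<lambda>_. N)) lborel (\<lambda>\<omega>. \<omega> v) = distr (PiM T (\<lambda>_. N)) borel (\<lambda>\<omega>. \<omega> v)"
      by (rule distr_cong) auto
    with marg[OF v] comp[OF v] show ?thesis by (simp add: distributed_def N_def)
  qed
  ultimately have "distributed (PiM T (\<lambda>_. N)) lborel (\<lambda>\<omega>. \<Sum>v\<in>I. \<omega> v)
      (normal_density (\<Sum>v\<in>I. 0) (sqrt (\<Sum>v\<in>I. s\<^sup>2)))"
    using finite_subset[OF I(1) T] I(2) s
    by (intro P.sum_indep_normal[where X = "\<lambda>v \<omega>. \<omega> v"])
  then show ?thesis
    using s by (simp add: N_def real_sqrt_mult)
qed

section \<open>The tree and its cone of flows\<close>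

instance vertex :: countable
  by countable_datatype

lemma finite_tree_vertices [simp]: "finite (tree_vertices \<alpha> n)"
proof -
  have "{Node j i | j i. j \<in> {1..num_paths \<alpha> n} \<and> i \<in> {1..path_length \<alpha> n}}
      = (\<lambda>(j, i). Node j i) ` ({1..num_paths \<alpha> n} \<times> {1..path_length \<alpha> n})" by auto
  then show ?thesis by (simp add: tree_vertices_def)
qed

lemma sum_tree_vertices:
  "(\<Sum>v\<in>tree_vertices \<alpha> n. f v)
     = f Root + (\<Sum>j=1..num_paths \<alpha> n. \<Sum>i=1..path_length \<alpha> n. f (Node j i))"
proof -
  let ?P = "{1..num_paths \<alpha> n} \<times> {1..path_length \<alpha> n}"
  have eq: "tree_vertices \<alpha> n = insert Root ((\<lambda>(j, i). Node j i) ` ?P)"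
    by (auto simp: tree_vertices_def)
  have inj: "inj_on (\<lambda>(j, i). Node j i) ?P" by (auto simp: inj_on_def)
  have "(\<Sum>v\<in>tree_vertices \<alpha> n. f v) = f Root + (\<Sum>v\<in>(\<lambda>(j, i). Node j i) ` ?P. f v)"
    unfolding eq by (subst sum.insert) auto
  also have "(\<Sum>v\<in>(\<lambda>(j, i). Node j i) ` ?P. f v) = (\<Sum>(j, i)\<in>?P. f (Node j i))"
    by (subst sum.reindex[OF inj]) (simp add: case_prod_beta)
  finally show ?thesis by (simp add: sum.cartesian_product)
qed

lemma num_paths_ge_1: "n \<ge> 1 \<Longrightarrow> num_paths \<alpha> n \<ge> 1"
  and path_length_ge_1: "n \<ge> 1 \<Longrightarrow> path_length \<alpha> n \<ge> 1"
  unfolding num_paths_def path_length_def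
  by (simp_all add: Suc_le_eq zero_less_ceiling)

lemma nat_ceiling_le_double:
  assumes "1 \<le> x" shows "real (nat \<lceil>x\<rceil>) \<le> 2 * x"
proof -
  have "real (nat \<lceil>x\<rceil>) = of_int \<lceil>x\<rceil>" using assms by simp
  then show ?thesis using ceiling_correct[of x] assms by linarith
qed

lemma num_paths_le:
  assumes "0 \<le> \<alpha>" "n \<ge> 1" shows "real (num_paths \<alpha> n) \<le> 2 * real n powr \<alpha>"
  unfolding num_paths_def using assms by (intro nat_ceiling_le_double ge_one_powr_ge_zero) auto

lemma path_length_le:
  assumes "\<alpha> \<le> 1" "n \<ge> 1" shows "real (path_length \<alpha> n) \<le> 2 * real n powr (1 - \<alpha>)"
  unfolding path_length_def using assms by (intro nat_ceiling_le_double ge_one_powr_ge_zero) auto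

lemma closed_flows: "closed (flows \<alpha> n)"
proof -
  have coord: "continuous_on UNIV (\<lambda>x::vertex \<Rightarrow> real. x v)" for v
    by (rule continuous_on_product_coordinates)
  \<comment> \<open>Membership in \<open>extensional\<close> is itself closed: one equation for each
    vertex off the tree.\<close>
  have "flows \<alpha> n = (\<Inter>v\<in>- tree_vertices \<alpha> n. {x. x v = undefined})
      \<inter> {x. (\<Sum>j=1..num_paths \<alpha> n. x (Node j 1)) \<le> x Root}
      \<inter> (\<Inter>j\<in>{1..num_paths \<alpha> n}. (\<Inter>i\<in>{1..<path_length \<alpha> n}. {x. x (Node j (Suc i)) \<le> x (Node j i)})
           \<inter> {x. 0 \<le> x (Node j (path_length \<alpha> n))})"
    by (auto simp: flows_def extensional_def)
  also have "closed \<dots>"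
    by (intro closed_Int closed_INT ballI closed_Collect_eq closed_Collect_le
        continuous_on_sum coord continuous_on_const)
  finally show ?thesis .
qed

text \<open>The value \<open>undefined\<close> off the tree is fixed by affine combinations, so \<open>flows\<close> is
  convex without restricting the combination to the tree.\<close>

lemma convex_flows:
  assumes x: "x \<in> flows \<alpha> n" and z: "z \<in> flows \<alpha> n" and t: "0 \<le> t" "t \<le> 1"
  shows "(\<lambda>v. (1 - t) * x v + t * z v) \<in> flows \<alpha> n"
proof -
  have mono: "(1 - t) * a + t * b \<le> (1 - t) * a' + t * b'" if "a \<le> a'" "b \<le> b'" for a b a' b'
    using that t by (intro add_mono mult_left_mono) auto
  have "(\<Sum>j = 1..num_paths \<alpha> n. (1 - t) * x (Node j 1) + t * z (Node j 1))
      = (1 - t) * (\<Sum>j = 1..num_paths \<alpha> n. x (Node j 1)) + t * (\<Sum>j = 1..num_paths \<alpha> n. z (Node j 1))"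
    by (simp add: sum.distrib sum_distrib_left)
  also have "\<dots> \<le> (1 - t) * x Root + t * z Root"
    using x z by (intro mono) (auto simp: flows_def)
  finally have root: "(\<Sum>j = 1..num_paths \<alpha> n. (1 - t) * x (Node j 1) + t * z (Node j 1))
      \<le> (1 - t) * x Root + t * z Root" .
  have "(1 - t) * u + t * u = u" for u :: real by (simp add: algebra_simps)
  then have "(\<lambda>v. (1 - t) * x v + t * z v) \<in> extensional (tree_vertices \<alpha> n)"
    using x z by (simp add: flows_def extensional_def)
  moreover have "0 \<le> (1 - t) * x v + t * z v" if "0 \<le> x v" "0 \<le> z v" for v
    using mono[OF that] by simp
  ultimately show ?thesis
    using root x z mono by (simp add: flows_def)
qed

section \<open>The least squares estimator: variational inequality and measurability\<close>

text \<open>Existence of a minimiser is what gives \<open>arg_min_on\<close> its meaning;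
  \<open>\<mu>\<close> witnesses that the cone is nonempty.\<close>

lemma lse_minimizes:
  assumes "\<mu> \<in> flows \<alpha> n"
  shows "lse \<alpha> n y \<in> flows \<alpha> n"
    and "z \<in> flows \<alpha> n \<Longrightarrow> tree_dist \<alpha> n y (lse \<alpha> n y) \<le> tree_dist \<alpha> n y z"
proof -
  obtain x where x: "x \<in> flows \<alpha> n" "\<And>z. z \<in> flows \<alpha> n \<Longrightarrow> tree_dist \<alpha> n y x \<le> tree_dist \<alpha> n y z"
    using ex_L2_minimizer[OF finite_tree_vertices[of \<alpha> n] closed_flows[of \<alpha> n], of y] assms
    by (auto simp: tree_dist_def flows_def)
  have "lse \<alpha> n y \<in> flows \<alpha> n \<and> (\<forall>z\<in>flows \<alpha> n. tree_dist \<alpha> n y (lse \<alpha> n y) \<le> tree_dist \<alpha> n y z)"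
    unfolding lse_def arg_min_on_def
    by (rule arg_minI[of _ x]) (use x in \<open>auto simp: not_less\<close>)
  then show "lse \<alpha> n y \<in> flows \<alpha> n"
    and "z \<in> flows \<alpha> n \<Longrightarrow> tree_dist \<alpha> n y (lse \<alpha> n y) \<le> tree_dist \<alpha> n y z" by auto
qed

lemma lse_variational:
  assumes "z \<in> flows \<alpha> n"
  shows "(\<Sum>v\<in>tree_vertices \<alpha> n. (y v - lse \<alpha> n y v) * (z v - lse \<alpha> n y v)) \<le> 0"
  using convex_flows[OF lse_minimizes(1)[OF assms] assms] lse_minimizes(2)[OF assms]
  by (intro L2_minimizer_variational[where K = "flows \<alpha> n"]) (auto simp: tree_dist_def)

lemma borel_measurable_lse_error:
  assumes "\<mu> \<in> flows \<alpha> n"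
  shows "(\<lambda>\<epsilon>. tree_dist \<alpha> n (lse \<alpha> n (\<lambda>v. \<mu> v + \<epsilon> v)) \<mu>) \<in> borel_measurable (error_law \<alpha> n \<sigma>)"
  unfolding error_law_def
proof (rule continuous_imp_measurable_PiM)
  define P where "P = (\<lambda>\<epsilon>. lse \<alpha> n (\<lambda>v. \<mu> v + \<epsilon> v))"
  have "\<bar>tree_dist \<alpha> n (P x) \<mu> - tree_dist \<alpha> n (P y) \<mu>\<bar>
      \<le> L2_set (\<lambda>v. x v - y v) (tree_vertices \<alpha> n)" for x y
  proof -
    have "L2_set (\<lambda>v. P x v - P y v) (tree_vertices \<alpha> n)
        \<le> L2_set (\<lambda>v. (\<mu> v + x v) - (\<mu> v + y v)) (tree_vertices \<alpha> n)"
      unfolding P_def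
      by (intro L2_projection_nonexpansive lse_variational lse_minimizes(1)[OF assms])
    then show ?thesis
      using abs_L2_set_diff_le[of "\<lambda>v. P x v - \<mu> v" _ "\<lambda>v. P y v - \<mu> v"]
      by (simp add: tree_dist_def) (meson order_trans)
  qed
  then show "continuous_on UNIV (\<lambda>\<epsilon>. tree_dist \<alpha> n (lse \<alpha> n (\<lambda>v. \<mu> v + \<epsilon> v)) \<mu>)"
    unfolding P_def by (rule continuous_on_if_L2_Lipschitz)
qed simp

section \<open>Deterministic bound on the error\<close>

text \<open>To be applied to the estimate and to the true flow separately, since their difference is
  in general not a flow.\<close>

lemma flow_paths_inner_le:
  assumes x: "x \<in> flows \<alpha> n" and n: "n \<ge> 1" and "0 \<le> M"
    and M: "\<And>j k. j \<in> {1..num_paths \<alpha> n} \<Longrightarrow> k \<in> {1..path_length \<alpha> n} \<Longrightarrow>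
      \<bar>\<Sum>i=1..k. \<epsilon> (Node j i)\<bar> \<le> M"
  shows "\<bar>\<Sum>j=1..num_paths \<alpha> n. \<Sum>i=1..path_length \<alpha> n. \<epsilon> (Node j i) * x (Node j i)\<bar> \<le> M * x Root"
proof -
  have "\<bar>\<Sum>j=1..num_paths \<alpha> n. \<Sum>i=1..path_length \<alpha> n. \<epsilon> (Node j i) * x (Node j i)\<bar>
      \<le> (\<Sum>j=1..num_paths \<alpha> n. M * x (Node j 1))"
  proof (rule order_trans[OF sum_abs sum_mono])
    fix j assume "j \<in> {1..num_paths \<alpha> n}"
    then show "\<bar>\<Sum>i=1..path_length \<alpha> n. \<epsilon> (Node j i) * x (Node j i)\<bar> \<le> M * x (Node j 1)"
      using x M path_length_ge_1[OF n]
      by (intro abs_sum_mult_antimono_le) (auto simp: flows_def)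
  qed
  also have "\<dots> \<le> M * x Root"
    using x \<open>0 \<le> M\<close> by (auto simp: sum_distrib_left[symmetric] flows_def intro!: mult_left_mono)
  finally show ?thesis .
qed

lemma lse_error_le:
  assumes \<mu>: "\<mu> \<in> flows \<alpha> n" and n: "n \<ge> 1"
    and M: "\<And>j k. j \<in> {1..num_paths \<alpha> n} \<Longrightarrow> k \<in> {1..path_length \<alpha> n} \<Longrightarrow>
      \<bar>\<Sum>i=1..k. \<epsilon> (Node j i)\<bar> \<le> M"
  shows "(tree_dist \<alpha> n (lse \<alpha> n (\<lambda>v. \<mu> v + \<epsilon> v)) \<mu>)\<^sup>2
    \<le> 2 * (\<epsilon> Root)\<^sup>2 + 2 * M\<^sup>2 + 4 * \<mu> Root * M"
proof -
  define x where "x = lse \<alpha> n (\<lambda>v. \<mu> v + \<epsilon> v)"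
  define d where "d = (\<lambda>v. x v - \<mu> v)"
  define D where "D = L2_set d (tree_vertices \<alpha> n)"
  define b where "b = \<bar>\<epsilon> Root\<bar> + M"
  have x: "x \<in> flows \<alpha> n" unfolding x_def by (rule lse_minimizes(1)[OF \<mu>])
  have M0: "0 \<le> M"
    using M[of 1 1] num_paths_ge_1[OF n, of \<alpha>] path_length_ge_1[OF n, of \<alpha>] by force
  have dR: "\<bar>d Root\<bar> \<le> D"
    unfolding D_def by (rule abs_le_L2_set[OF finite_tree_vertices]) (simp add: tree_vertices_def)
  have "D\<^sup>2 - (\<Sum>v\<in>tree_vertices \<alpha> n. \<epsilon> v * d v)
      = (\<Sum>v\<in>tree_vertices \<alpha> n. (\<mu> v + \<epsilon> v - x v) * (\<mu> v - x v))"
    by (simp add: D_def L2_set_def sum_nonneg d_def sum_subtractf[symmetric])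
       (simp add: power2_eq_square algebra_simps)
  also have "\<dots> \<le> 0" unfolding x_def by (rule lse_variational[OF \<mu>])
  finally have "D\<^sup>2 \<le> (\<Sum>v\<in>tree_vertices \<alpha> n. \<epsilon> v * d v)" by simp
  also have "\<dots> = \<epsilon> Root * d Root
      + ((\<Sum>j=1..num_paths \<alpha> n. \<Sum>i=1..path_length \<alpha> n. \<epsilon> (Node j i) * x (Node j i))
       - (\<Sum>j=1..num_paths \<alpha> n. \<Sum>i=1..path_length \<alpha> n. \<epsilon> (Node j i) * \<mu> (Node j i)))"
    by (simp add: sum_tree_vertices d_def right_diff_distrib sum_subtractf)
  also have "\<dots> \<le> \<epsilon> Root * d Root + (M * x Root + M * \<mu> Root)"
    using flow_paths_inner_le[OF x n M0 M] flow_paths_inner_le[OF \<mu> n M0 M] by linarith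
  \<comment> \<open>The root value of the estimate has no a priori bound. Writing it as
    \<open>\<mu> Root + d Root\<close> lets the excess be absorbed into a multiple of
    \<open>D\<close>.\<close>
  also have "\<dots> = \<epsilon> Root * d Root + M * d Root + 2 * (M * \<mu> Root)"
    by (simp add: d_def algebra_simps)
  also have "\<dots> \<le> \<bar>\<epsilon> Root\<bar> * D + M * D + 2 * (M * \<mu> Root)"
  proof -
    have "\<epsilon> Root * d Root \<le> \<bar>\<epsilon> Root\<bar> * D"
      using mult_left_mono[OF dR, of "\<bar>\<epsilon> Root\<bar>"] by (simp add: abs_mult[symmetric])
    moreover have "M * d Root \<le> M * D" using dR M0 by (intro mult_left_mono) auto
    ultimately show ?thesis by simp
  qed
  finally have "D\<^sup>2 \<le> b * D + 2 * (M * \<mu> Root)" by (simp add: b_def distrib_right)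
  \<comment> \<open>Half of \<open>D\<^sup>2\<close> absorbs the term linear in \<open>D\<close>,
    leaving \<open>D\<^sup>2 \<le> b\<^sup>2 + 4 * (M * \<mu> Root)\<close>.\<close>
  moreover have "2 * (b * D) \<le> b\<^sup>2 + D\<^sup>2"
    using sum_squares_bound[of b D] by simp
  moreover have "b\<^sup>2 \<le> 2 * (\<epsilon> Root)\<^sup>2 + 2 * M\<^sup>2"
    using sum_squares_bound[of "\<bar>\<epsilon> Root\<bar>" M] by (simp add: b_def power2_sum)
  ultimately have "D\<^sup>2 \<le> 2 * (\<epsilon> Root)\<^sup>2 + 2 * M\<^sup>2 + 4 * \<mu> Root * M" by (simp add: mult_ac)
  then show ?thesis by (simp add: D_def d_def x_def tree_dist_def)
qed

section \<open>Maximal inequality and bound on the risk\<close>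

text \<open>A pointwise substitute for the maximal inequality: it makes Jensen's inequality unnecessary
  when expectations are taken.\<close>

lemma square_le_log_sum_exp:
  fixes S :: "'i \<Rightarrow> real"
  assumes "finite I" "p \<in> I" "0 < v" and N: "0 < N"
  shows "(S p)\<^sup>2 \<le> 4 * v * (ln N + (\<Sum>q\<in>I. exp ((S q)\<^sup>2 / (4 * v))) / N)"
proof -
  define t where "t = (S p)\<^sup>2 / (4 * v)"
  \<comment> \<open>The shift by \<open>ln N\<close> divides the sum of exponentials by
    \<open>N\<close>; with \<open>N\<close> the number of terms, that sum becomes an
    average.\<close>
  have "t - ln N \<le> exp (t - ln N)"
    using exp_ge_add_one_self[of "t - ln N"] by linarith
  also have "\<dots> = exp t / N" using N by (simp add: exp_diff)
  also have "\<dots> \<le> (\<Sum>q\<in>I. exp ((S q)\<^sup>2 / (4 * v))) / N"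
    unfolding t_def using assms
    by (intro divide_right_mono member_le_sum[of p I "\<lambda>q. exp ((S q)\<^sup>2 / (4 * v))"]) auto
  finally have "4 * v * t \<le> 4 * v * (ln N + (\<Sum>q\<in>I. exp ((S q)\<^sup>2 / (4 * v))) / N)"
    using \<open>0 < v\<close> by (intro mult_left_mono) auto
  then show ?thesis using \<open>0 < v\<close> by (simp add: t_def)
qed

text \<open>A partial sum of \<open>k\<close> errors has variance k \<sigma>^2, at most
  \<open>v\<close>, so all partial sums share the scale of a full path.\<close>

lemma path_sum_exp_square:
  assumes \<sigma>: "\<sigma> > 0" and j: "j \<in> {1..num_paths \<alpha> n}" and k: "k \<in> {1..path_length \<alpha> n}"
  defines "v \<equiv> real (path_length \<alpha> n) * \<sigma>\<^sup>2"
  shows "integrable (error_law \<alpha> n \<sigma>) (\<lambda>\<epsilon>. exp ((\<Sum>i=1..k. \<epsilon> (Node j i))\<^sup>2 / (4 * v)))"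
    and "(\<integral>\<epsilon>. exp ((\<Sum>i=1..k. \<epsilon> (Node j i))\<^sup>2 / (4 * v)) \<partial>error_law \<alpha> n \<sigma>) \<le> sqrt 2"
proof -
  have inj: "inj_on (Node j) {1..k}" by (simp add: inj_on_def)
  have "Node j ` {1..k} \<subseteq> tree_vertices \<alpha> n" "Node j ` {1..k} \<noteq> {}"
    using j k by (auto simp: tree_vertices_def)
  from distributed_sum_PiM_normal[OF finite_tree_vertices this \<sigma>]
  have D: "distributed (error_law \<alpha> n \<sigma>) lborel (\<lambda>\<epsilon>. \<Sum>i=1..k. \<epsilon> (Node j i))
      (normal_density 0 (sqrt (real k) * \<sigma>))"
    by (simp add: error_law_def sum.reindex[OF inj] card_image[OF inj] del: One_nat_def)
  have "0 < sqrt (real k) * \<sigma>" "(sqrt (real k) * \<sigma>)\<^sup>2 \<le> v"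
    using k \<sigma> by (auto simp: v_def power_mult_distrib)
  from distributed_normal_exp_square[OF D this]
  show "integrable (error_law \<alpha> n \<sigma>) (\<lambda>\<epsilon>. exp ((\<Sum>i=1..k. \<epsilon> (Node j i))\<^sup>2 / (4 * v)))"
    and "(\<integral>\<epsilon>. exp ((\<Sum>i=1..k. \<epsilon> (Node j i))\<^sup>2 / (4 * v)) \<partial>error_law \<alpha> n \<sigma>) \<le> sqrt 2" .
qed

lemma root_exp_square:
  assumes \<sigma>: "\<sigma> > 0" and v: "\<sigma>\<^sup>2 \<le> v"
  shows "integrable (error_law \<alpha> n \<sigma>) (\<lambda>\<epsilon>. exp ((\<epsilon> Root)\<^sup>2 / (4 * v)))"
    and "(\<integral>\<epsilon>. exp ((\<epsilon> Root)\<^sup>2 / (4 * v)) \<partial>error_law \<alpha> n \<sigma>) \<le> sqrt 2"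
proof -
  have D: "distributed (error_law \<alpha> n \<sigma>) lborel (\<lambda>\<epsilon>. \<epsilon> Root) (normal_density 0 \<sigma>)"
    using distributed_sum_PiM_normal[OF finite_tree_vertices[of \<alpha> n] _ _ \<sigma>, of "{Root}"]
    by (simp add: error_law_def tree_vertices_def)
  show "integrable (error_law \<alpha> n \<sigma>) (\<lambda>\<epsilon>. exp ((\<epsilon> Root)\<^sup>2 / (4 * v)))"
    and "(\<integral>\<epsilon>. exp ((\<epsilon> Root)\<^sup>2 / (4 * v)) \<partial>error_law \<alpha> n \<sigma>) \<le> sqrt 2"
    using distributed_normal_exp_square[OF D \<sigma> v] .
qed

text \<open>The free parameter \<open>a\<close> linearises the square root in the cross term, so
  only the mean of the maximal bound enters, and \<open>A\<close> bounds that mean. The value of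
  \<open>a\<close> is left to the final estimate.\<close>

lemma lse_risk_le:
  assumes \<mu>: "\<mu> \<in> flows \<alpha> n" and n: "n \<ge> 1" and \<sigma>: "\<sigma> > 0"
    and V: "\<mu> Root \<le> V" "0 \<le> V" and a: "a > 0"
  defines "v \<equiv> real (path_length \<alpha> n) * \<sigma>\<^sup>2"
  defines "A \<equiv> 4 * v * (ln (real (num_paths \<alpha> n) * real (path_length \<alpha> n)) + sqrt 2)"
  defines "loss \<equiv> \<lambda>\<epsilon>. (tree_dist \<alpha> n (lse \<alpha> n (\<lambda>v. \<mu> v + \<epsilon> v)) \<mu>)\<^sup>2"
  shows "integrable (error_law \<alpha> n \<sigma>) loss"
    and "integral\<^sup>L (error_law \<alpha> n \<sigma>) loss \<le> 8 * v * sqrt 2 + 2 * A + 2 * V * (A / a + a)"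
proof -
  let ?E = "error_law \<alpha> n \<sigma>"
  define N where "N = real (num_paths \<alpha> n) * real (path_length \<alpha> n)"
  define I where "I = {1..num_paths \<alpha> n} \<times> {1..path_length \<alpha> n}"
  define S where "S = (\<lambda>\<epsilon> (j, k). \<Sum>i=1..k. \<epsilon> (Node j i) :: real)"
  define G where "G = (\<lambda>p \<epsilon>. exp ((S \<epsilon> p)\<^sup>2 / (4 * v)))"
  define R where "R = (\<lambda>\<epsilon>. exp ((\<epsilon> Root)\<^sup>2 / (4 * v)) :: real)"
  \<comment> \<open>\<open>W\<close> dominates all squared path sums at once. Here \<open>N\<close>
    counts these sums, so the averaged exponentials have mean at most \<open>sqrt 2\<close>.\<close>
  define W where "W = (\<lambda>\<epsilon>. 4 * v * (ln N + (\<Sum>p\<in>I. G p \<epsilon>) / N))"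
  define U where "U = (\<lambda>\<epsilon>. 8 * v * R \<epsilon> + 2 * W \<epsilon> + 2 * V * (W \<epsilon> / a + a))"
  have l: "1 \<le> real (path_length \<alpha> n)" and m: "1 \<le> real (num_paths \<alpha> n)"
    using path_length_ge_1[OF n, of \<alpha>] num_paths_ge_1[OF n, of \<alpha>] by auto
  have v: "\<sigma>\<^sup>2 \<le> v" "0 < v" using l \<sigma> by (simp_all add: v_def)
  have N: "N \<ge> 1" unfolding N_def using l m mult_mono[of 1 _ 1] by fastforce
  have card: "real (card I) = N" by (simp add: I_def N_def)
  have "finite I" by (simp add: I_def)
  interpret prob_space ?E
    unfolding error_law_def using \<sigma> by (intro prob_space_PiM prob_space_normal_density)
  have G: "integrable ?E (G p)" "integral\<^sup>L ?E (G p) \<le> sqrt 2" if "p \<in> I" for p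
    using path_sum_exp_square[OF \<sigma>, of "fst p" \<alpha> n "snd p"] that
    by (auto simp: G_def S_def I_def v_def case_prod_beta)
  have R: "integrable ?E R" "integral\<^sup>L ?E R \<le> sqrt 2"
    unfolding R_def using root_exp_square[OF \<sigma> v(1)] by auto
  have W: "integrable ?E W" "integral\<^sup>L ?E W \<le> A"
  proof -
    have GI: "integrable ?E (\<lambda>\<epsilon>. (\<Sum>p\<in>I. G p \<epsilon>) / N)" using G by auto
    then show "integrable ?E W" unfolding W_def by auto
    have "integral\<^sup>L ?E W = 4 * v * (ln N + (\<Sum>p\<in>I. integral\<^sup>L ?E (G p)) / N)"
      unfolding W_def using G(1) GI by (simp add: prob_space)
    also have "\<dots> \<le> 4 * v * (ln N + sqrt 2)"
    proof -
      have "(\<Sum>p\<in>I. integral\<^sup>L ?E (G p)) \<le> N * sqrt 2"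
        using sum_bounded_above[of I "\<lambda>p. integral\<^sup>L ?E (G p)" "sqrt 2"] G(2) card by simp
      then show ?thesis using v N by (intro mult_left_mono add_left_mono) (auto simp: field_simps)
    qed
    finally show "integral\<^sup>L ?E W \<le> A" by (simp add: A_def N_def)
  qed
  have U: "integrable ?E U" unfolding U_def using R(1) W(1) by auto
  have loss_le: "loss \<epsilon> \<le> U \<epsilon>" for \<epsilon>
  proof -
    have SW: "(S \<epsilon> p)\<^sup>2 \<le> W \<epsilon>" if "p \<in> I" for p
      unfolding W_def G_def using square_le_log_sum_exp[OF \<open>finite I\<close> that v(2)] N by simp
    have W0: "0 \<le> W \<epsilon>"
      unfolding W_def G_def using v N by (intro mult_nonneg_nonneg add_nonneg_nonneg) (auto intro!: sum_nonneg divide_nonneg_pos)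
    have "\<bar>S \<epsilon> p\<bar> \<le> sqrt (W \<epsilon>)" if "p \<in> I" for p
      using real_sqrt_le_mono[OF SW[OF that]] by simp
    \<comment> \<open>\<open>sqrt (W \<epsilon>)\<close> takes the place of \<open>M\<close> in the
      deterministic bound.\<close>
    then have "\<bar>\<Sum>i=1..k. \<epsilon> (Node j i)\<bar> \<le> sqrt (W \<epsilon>)"
      if "j \<in> {1..num_paths \<alpha> n}" "k \<in> {1..path_length \<alpha> n}" for j k
      using that by (force simp: S_def I_def)
    from lse_error_le[OF \<mu> n this]
    have 1: "loss \<epsilon> \<le> 2 * (\<epsilon> Root)\<^sup>2 + 2 * W \<epsilon> + 4 * \<mu> Root * sqrt (W \<epsilon>)"
      using W0 by (simp add: loss_def)
    have 2: "(\<epsilon> Root)\<^sup>2 \<le> 4 * v * R \<epsilon>"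
    proof -
      have "(\<epsilon> Root)\<^sup>2 / (4 * v) \<le> R \<epsilon>"
        unfolding R_def using exp_ge_add_one_self[of "(\<epsilon> Root)\<^sup>2 / (4 * v)"] by linarith
      then show ?thesis using v by (simp add: field_simps)
    qed
    \<comment> \<open>AM-GM, then division by \<open>a\<close>.\<close>
    have "2 * sqrt (W \<epsilon>) * a \<le> W \<epsilon> + a\<^sup>2"
      using sum_squares_bound[of "sqrt (W \<epsilon>)" a] W0 by simp
    then have 3: "2 * sqrt (W \<epsilon>) \<le> W \<epsilon> / a + a"
      using a by (simp add: field_simps power2_eq_square)
    have "4 * \<mu> Root * sqrt (W \<epsilon>) \<le> 2 * V * (2 * sqrt (W \<epsilon>))"
      using V W0 by (simp add: mult_right_mono)
    also have "\<dots> \<le> 2 * V * (W \<epsilon> / a + a)" using 3 V by (intro mult_left_mono) auto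
    finally show ?thesis using 1 2 unfolding U_def by linarith
  qed
  show int: "integrable ?E loss"
  proof (rule Bochner_Integration.integrable_bound[OF U])
    show "loss \<in> borel_measurable ?E"
      unfolding loss_def using borel_measurable_lse_error[OF \<mu>] by measurable
    have "norm (loss \<epsilon>) \<le> norm (U \<epsilon>)" for \<epsilon>
      using loss_le[of \<epsilon>] zero_le_power2 by (simp add: loss_def)
    then show "AE \<epsilon> in ?E. norm (loss \<epsilon>) \<le> norm (U \<epsilon>)" by simp
  qed
  have "integral\<^sup>L ?E loss \<le> integral\<^sup>L ?E U"
    by (rule integral_mono[OF int U loss_le])
  also have "\<dots> = 8 * v * integral\<^sup>L ?E R + 2 * integral\<^sup>L ?E W + 2 * V * (integral\<^sup>L ?E W / a + a)"
    unfolding U_def using R(1) W(1) by (simp add: prob_space)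
  also have "\<dots> \<le> 8 * v * sqrt 2 + 2 * A + 2 * V * (A / a + a)"
    using R(2) W(2) V v a by (intro add_mono mult_left_mono divide_right_mono) auto
  finally show "integral\<^sup>L ?E loss \<le> 8 * v * sqrt 2 + 2 * A + 2 * V * (A / a + a)" .
qed

section \<open>Choice of the parameter and the rate in \<open>n\<close>\<close>

theorem theorem2p5:
  "\<exists>C::real. C > 0 \<and>
     (\<forall>(\<alpha>::real) (n::nat) (V::real) (\<sigma>::real) (\<mu>::vertex \<Rightarrow> real).
        0 \<le> \<alpha> \<and> \<alpha> \<le> 1 \<and> n \<ge> 1 \<and> V \<ge> 0 \<and> \<sigma> > 0 \<and> \<mu> \<in> flows \<alpha> n \<and> \<mu> Root \<le> V \<longrightarrow>
        integrable (error_law \<alpha> n \<sigma>) (scaled_loss \<alpha> n \<mu>) \<and>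
        integral\<^sup>L (error_law \<alpha> n \<sigma>) (scaled_loss \<alpha> n \<mu>)
          \<le> C * (\<sigma>\<^sup>2 * ln (exp 1 * real n) ^ 3 / real n powr \<alpha>
                 + V * (\<sigma> * ln (exp 1 * real n) powr (3/2) / real n powr \<alpha>)))"
proof (intro exI[of _ 80] conjI allI impI)
  \<comment> \<open>80 = 2 * 40: the 2 is the rounding loss in the path length, and 40 = 12 + 28
    collects \<open>8 * v * sqrt 2\<close> and \<open>2 * A\<close>.\<close>
  show "(0::real) < 80" by simp
next
  fix \<alpha> V \<sigma> :: real and n :: nat and \<mu> :: "vertex \<Rightarrow> real"
  assume asm: "0 \<le> \<alpha> \<and> \<alpha> \<le> 1 \<and> n \<ge> 1 \<and> V \<ge> 0 \<and> \<sigma> > 0 \<and> \<mu> \<in> flows \<alpha> n \<and> \<mu> Root \<le> V"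
  then have \<mu>: "\<mu> \<in> flows \<alpha> n" and n: "n \<ge> 1" and \<sigma>: "\<sigma> > 0" and V: "\<mu> Root \<le> V" "0 \<le> V" by auto
  define L where "L = ln (exp 1 * real n)"
  define l where "l = real (path_length \<alpha> n)"
  define N where "N = real (num_paths \<alpha> n) * l"
  define v where "v = l * \<sigma>\<^sup>2"
  define Q where "Q = L powr (3/2)"
  \<comment> \<open>Chosen so that \<open>V * a\<close> is \<open>l\<close> times the target term
    \<sigma> L^(3/2). It is large enough that \<open>A / a\<close> is at most a multiple of
    \<open>a\<close>, since \<open>A\<close> has order at most l \<sigma>^2 L.\<close>
  define a where "a = \<sigma> * l * Q"
  define A where "A = 4 * v * (ln N + sqrt 2)"
  have L: "L = 1 + ln (real n)" using n by (simp add: L_def ln_mult)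
  then have L1: "1 \<le> L" using n by simp
  have l1: "1 \<le> l" using path_length_ge_1[OF n, of \<alpha>] by (simp add: l_def)
  have Q: "L \<le> Q" using powr_mono[of 1 "3/2" L] L1 by (simp add: Q_def)
  have "L ^ 1 \<le> L ^ 3" using L1 by (intro power_increasing) auto
  then have L3: "L \<le> L ^ 3" by simp
  have a0: "a > 0" using \<sigma> l1 Q L1 by (simp add: a_def)
  have v0: "v > 0" using \<sigma> l1 by (simp add: v_def)
  have sqrt2: "sqrt 2 \<le> (3/2::real)" by (rule real_le_lsqrt) (auto simp: power2_eq_square)
  \<comment> \<open>Each ceiling at most doubles a number that is at least 1, and the powers of
    \<open>n\<close> multiply to \<open>n\<close>.\<close>
  have "N \<le> (2 * real n powr \<alpha>) * (2 * real n powr (1 - \<alpha>))"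
    unfolding N_def l_def using asm by (intro mult_mono num_paths_le path_length_le) auto
  also have "\<dots> = 4 * real n" using n by (simp add: powr_add[symmetric])
  finally have N: "N \<le> 4 * real n" .
  have "1 \<le> N"
    using mult_mono[of 1 "real (num_paths \<alpha> n)" 1 l] num_paths_ge_1[OF n, of \<alpha>] l1 by (simp add: N_def)
  then have "ln N \<le> ln (4 * real n)" using N by (intro ln_mono) auto
  also have "\<dots> = 2 * ln 2 + ln (real n)"
    using n ln_mult[of "2::real" 2] by (simp add: ln_mult)
  also have "\<dots> \<le> 1 + L" using ln_2_less_1 L by linarith
  \<comment> \<open>The constants 1 and 3/2 are absorbed into multiples of \<open>L\<close> by
    \<open>1 \<le> L\<close>.\<close>
  finally have "ln N + sqrt 2 \<le> 7/2 * L" using sqrt2 L1 by linarith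
  then have "A \<le> 4 * v * (7/2 * L)" unfolding A_def using v0 by (intro mult_left_mono) auto
  then have A: "A \<le> 14 * (v * L)" by (simp add: mult_ac)
  have "A / a \<le> 14 * (v * L) / a" using A a0 by (intro divide_right_mono) auto
  also have "\<dots> = 14 * \<sigma> * (L / Q)"
    using \<sigma> l1 by (simp add: a_def v_def power2_eq_square)
  also have "\<dots> \<le> 14 * \<sigma>"
    using mult_left_mono[of "L / Q" 1 "14 * \<sigma>"] Q L1 \<sigma> by simp
  also have "\<dots> \<le> 14 * a"
  proof -
    have "1 \<le> l * Q" using mult_mono[of 1 l 1 Q] l1 Q L1 by simp
    then show ?thesis using \<sigma> by (simp add: a_def mult.assoc)
  qed
  finally have Aa: "A / a + a \<le> 15 * a" by simp
  define loss where "loss = (\<lambda>\<epsilon>. (tree_dist \<alpha> n (lse \<alpha> n (\<lambda>v. \<mu> v + \<epsilon> v)) \<mu>)\<^sup>2)"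
  have sl: "scaled_loss \<alpha> n \<mu> = (\<lambda>\<epsilon>. 1 / real n * loss \<epsilon>)"
    by (simp add: scaled_loss_def loss_def fun_eq_iff)
  have int: "integrable (error_law \<alpha> n \<sigma>) loss"
    and risk: "integral\<^sup>L (error_law \<alpha> n \<sigma>) loss \<le> 8 * v * sqrt 2 + 2 * A + 2 * V * (A / a + a)"
    using lse_risk_le[OF \<mu> n \<sigma> V a0] unfolding loss_def A_def N_def v_def l_def by auto
  show "integrable (error_law \<alpha> n \<sigma>) (scaled_loss \<alpha> n \<mu>)"
    unfolding sl using int by simp
  note risk
  also have "8 * v * sqrt 2 + 2 * A + 2 * V * (A / a + a) \<le> 40 * (v * L ^ 3) + 30 * (V * a)"
  proof -
    have "8 * v * sqrt 2 \<le> 8 * v * (3/2)" using sqrt2 v0 by (intro mult_left_mono) auto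
    moreover have "v * 1 \<le> v * L" "v * L \<le> v * L ^ 3"
      using v0 L1 L3 by (auto intro!: mult_left_mono)
    moreover have "2 * V * (A / a + a) \<le> 2 * V * (15 * a)"
      using Aa V by (intro mult_left_mono) auto
    ultimately show ?thesis using A by (simp add: mult.assoc)
  qed
  \<comment> \<open>Both \<open>v\<close> and \<open>a\<close> carry the factor \<open>l\<close>; 30
    is raised to 40 to share one constant.\<close>
  also have "\<dots> \<le> l * (40 * (\<sigma>\<^sup>2 * L ^ 3 + V * (\<sigma> * Q)))"
    using V \<sigma> l1 L1 by (simp add: v_def a_def Q_def algebra_simps mult_left_mono)
  finally have bound: "integral\<^sup>L (error_law \<alpha> n \<sigma>) loss \<le> l * (40 * (\<sigma>\<^sup>2 * L ^ 3 + V * (\<sigma> * Q)))" .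
  \<comment> \<open>The rate \<open>n powr (-\<alpha>)\<close> arises here, as the path length
    divided by \<open>n\<close>.\<close>
  have "l \<le> 2 * (real n / real n powr \<alpha>)"
    using path_length_le[of \<alpha> n] asm by (simp add: l_def powr_diff)
  then have ln: "l / real n \<le> 2 / real n powr \<alpha>" using n by (simp add: field_simps)
  have "integral\<^sup>L (error_law \<alpha> n \<sigma>) (scaled_loss \<alpha> n \<mu>) = integral\<^sup>L (error_law \<alpha> n \<sigma>) loss / real n"
    unfolding sl using int by simp
  also have "\<dots> \<le> (l / real n) * (40 * (\<sigma>\<^sup>2 * L ^ 3 + V * (\<sigma> * Q)))"
    using divide_right_mono[OF bound, of "real n"] by simp
  also have "\<dots> \<le> (2 / real n powr \<alpha>) * (40 * (\<sigma>\<^sup>2 * L ^ 3 + V * (\<sigma> * Q)))"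
    using ln V \<sigma> L1 Q by (intro mult_right_mono) auto
  finally show "integral\<^sup>L (error_law \<alpha> n \<sigma>) (scaled_loss \<alpha> n \<mu>)
      \<le> 80 * (\<sigma>\<^sup>2 * ln (exp 1 * real n) ^ 3 / real n powr \<alpha>
               + V * (\<sigma> * ln (exp 1 * real n) powr (3/2) / real n powr \<alpha>))"
    by (simp add: L_def Q_def add_divide_distrib algebra_simps)
qed

end
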